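(* Let $k\ge1$ and $l\ge1$ be integers, put $\mu=\max\{k,l\}$, and let $0<c<1$ be a constant. For any graph $G$ of order $n$ with minimum degree $\delta$ satisfying $\mu\le(1-c)\ln\delta$, $$\gamma_{k,l}(G)<\left(\frac{\ln\delta}{\delta+1}+\frac{\mu}{\delta^{0.5c^2}}\right)n .$$
   Context: All graphs are finite, undirected, without loops and multiple edges (and nonempty). $N[v]$ denotes the closed neighbourhood of $v$ (the neighbours of $v$ together with $v$). For integers $k\ge1$ and $l\ge1$, a set $D\subseteq V(G)$ is a $(k,l)$-dominating set of $G$ if $|N[v]\cap D|\ge k$ for every vertex $v\notin D$ and $|N[v]\cap D|\ge l$ for every vertex $v\in D$. The parametric domination number $\gamma_{k,l}(G)$ is the minimum cardinality of a $(k,l)$-dominating set of $G$. *)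

theory Defs
  imports Complex_Main "Graph_Theory.Pair_Digraph"
begin

text \<open>
  A simple graph is a \<^locale>\<open>pair_graph\<close>: a finite, loop-free digraph whose arcs form a symmetric
  set of pairs of vertices, an edge \<open>uv\<close> being represented by the two arcs \<open>(u, v)\<close> and \<open>(v, u)\<close>.
  Hence the degree of a vertex is its out-degree.
\<close>

definition closed_nbhd :: "'a pair_pre_digraph \<Rightarrow> 'a \<Rightarrow> 'a set" where
  "closed_nbhd G v = insert v {u. (v, u) \<in> parcs G}"

definition min_degree :: "'a pair_pre_digraph \<Rightarrow> nat" where
  "min_degree G = Min (out_degree (with_proj G) ` pverts G)"

definition kl_dominating :: "nat \<Rightarrow> nat \<Rightarrow> 'a pair_pre_digraph \<Rightarrow> 'a set \<Rightarrow> bool" where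
  "kl_dominating k l G D \<longleftrightarrow> D \<subseteq> pverts G \<and>
     (\<forall>v \<in> pverts G - D. card (closed_nbhd G v \<inter> D) \<ge> k) \<and>
     (\<forall>v \<in> D. card (closed_nbhd G v \<inter> D) \<ge> l)"

text \<open>
  The minimum is over a nonempty set at least when \<open>l \<le> min_degree G + 1\<close>, see
  \<open>kl_dominating_pverts\<close> below; the value is unspecified if no \<open>(k, l)\<close>-dominating set exists.
\<close>

definition kl_domination_number :: "nat \<Rightarrow> nat \<Rightarrow> 'a pair_pre_digraph \<Rightarrow> nat" where
  "kl_domination_number k l G = Min (card ` {D. kl_dominating k l G D})"

lemma (in pair_graph) closed_nbhd_subset:
  "v \<in> pverts G \<Longrightarrow> closed_nbhd G v \<subseteq> pverts G"
  by (auto simp: closed_nbhd_def dest: in_arcsD2)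

lemma (in pair_graph) card_closed_nbhd:
  assumes "v \<in> pverts G"
  shows "card (closed_nbhd G v) = out_degree (with_proj G) v + 1"
proof -
  have eq: "out_arcs (with_proj G) v = Pair v ` {u. (v, u) \<in> parcs G}"
    by (auto simp: out_arcs_def)
  have "card (out_arcs (with_proj G) v) = card {u. (v, u) \<in> parcs G}"
    unfolding eq by (rule card_image) (auto simp: inj_on_def)
  moreover have "finite {u. (v, u) \<in> parcs G}"
    by (rule finite_subset[OF _ pair_finite_verts]) (auto dest: in_arcsD2)
  moreover have "v \<notin> {u. (v, u) \<in> parcs G}"
    using no_loops' by auto
  ultimately show ?thesis
    by (simp add: closed_nbhd_def out_degree_def)
qed

lemma (in pair_graph) kl_dominating_pverts:
  assumes "l \<le> min_degree G + 1"
  shows "kl_dominating k l G (pverts G)"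
proof -
  have "l \<le> card (closed_nbhd G v \<inter> pverts G)" if v: "v \<in> pverts G" for v
  proof -
    have "min_degree G \<le> out_degree (with_proj G) v"
      unfolding min_degree_def using v pair_finite_verts by (intro Min_le) auto
    moreover have "closed_nbhd G v \<inter> pverts G = closed_nbhd G v"
      using closed_nbhd_subset[OF v] by blast
    ultimately show ?thesis
      using assms card_closed_nbhd[OF v] by simp
  qed
  then show ?thesis by (simp add: kl_dominating_def)
qed

end

theory Submission
  imports Defs
begin

text \<open>
  The bound comes from the alteration method. Put every vertex into a random set \<open>A\<close>
  independently with probability \<open>p = ln \<delta> / (\<delta> + 1)\<close>; then, for every vertex \<open>v\<close> whose
  closed neighbourhood meets \<open>A\<close> in fewer than \<open>\<mu>\<close> vertices, add as many vertices of \<open>N[v]\<close> as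
  are missing. The resulting set meets every closed neighbourhood at least \<open>\<mu> = max k l\<close> times, so
  it is \<open>(k, l)\<close>-dominating. The set \<open>A\<close> has \<open>p n\<close> elements on average, which is the first term of
  the bound. The deficiency of \<open>v\<close> is at most \<open>\<mu>\<close> and vanishes unless
  \<open>\<bar>N[v] \<inter> A\<bar> < \<mu> \<le> (1 - c) ln \<delta>\<close>. As \<open>N[v]\<close> has at least \<open>\<delta> + 1\<close> elements, the mean of
  \<open>\<bar>N[v] \<inter> A\<bar>\<close> is at least \<open>ln \<delta>\<close>, so this is a deviation below the mean by a factor \<open>1 - c\<close>,
  and Chernoff's bound gives it a probability less than \<open>exp (- c\<^sup>2 ln \<delta> / 2)\<close>, which yields the
  second term.

  Only finitely many subsets are involved, so expectations are finite sums with explicit weights,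
  and all of them reduce to the generating identity \<open>sum_subset_weight_prod\<close>. The
  deterministic step is \<open>repair_to_multiple_transversal\<close>, the tail estimate is
  \<open>expected_deficiency_less\<close>, and \<open>small_multiple_transversal\<close> combines them for arbitrary set
  families; closed neighbourhoods are the special case needed for domination.
\<close>

section \<open>Random subsets of a finite set\<close>

text \<open>
  The probability that the random subset of \<open>V\<close> which contains each element independently with
  probability \<open>p\<close> is \<open>A\<close>.
\<close>

definition subset_weight :: "real \<Rightarrow> 'a set \<Rightarrow> 'a set \<Rightarrow> real" where
  "subset_weight p V A = p ^ card A * (1 - p) ^ card (V - A)"

lemma subset_weight_nonneg: "0 \<le> p \<Longrightarrow> p \<le> 1 \<Longrightarrow> 0 \<le> subset_weight p V A"
  by (simp add: subset_weight_def)

text \<open>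
  Independence: a random variable that is a product of one factor per chosen element has
  expectation equal to the product of the expectations. The expectations used below are
  all obtained from suitable \<open>h\<close>.
\<close>

lemma sum_subset_weight_prod:
  assumes "finite V"
  shows "(\<Sum>A\<in>Pow V. subset_weight p V A * (\<Prod>v\<in>A. h v)) = (\<Prod>v\<in>V. 1 - p * (1 - h v))"
proof -
  have "(\<Prod>v\<in>V. 1 - p * (1 - h v)) = (\<Prod>v\<in>V. p * h v + (1 - p))"
    by (simp add: algebra_simps)
  also have "\<dots> = (\<Sum>A\<in>Pow V. (\<Prod>v\<in>A. p * h v) * (\<Prod>v\<in>V - A. 1 - p))"
    using assms by (rule prod_add)
  also have "\<dots> = (\<Sum>A\<in>Pow V. subset_weight p V A * (\<Prod>v\<in>A. h v))"
    by (simp add: subset_weight_def prod.distrib mult_ac)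
  finally show ?thesis ..
qed

lemma sum_subset_weight: "finite V \<Longrightarrow> (\<Sum>A\<in>Pow V. subset_weight p V A) = 1"
  using sum_subset_weight_prod[of V p "\<lambda>_. 1"] by simp

lemma sum_subset_weight_card:
  assumes "finite V"
  shows "(\<Sum>A\<in>Pow V. subset_weight p V A * real (card A)) = p * real (card V)"
proof -
  \<comment> \<open>The event \<open>v \<notin> A\<close> is a product over \<open>A\<close>, unlike \<open>v \<in> A\<close>.\<close>
  have not_mem: "(\<Sum>A\<in>Pow V. subset_weight p V A * of_bool (v \<notin> A)) = 1 - p" if "v \<in> V" for v
  proof -
    have "(\<Prod>u\<in>A. of_bool (u \<noteq> v)) = (of_bool (v \<notin> A) :: real)" if "A \<in> Pow V" for A
      using that finite_subset[OF _ assms, of A] by (auto simp: prod_zero_iff intro: prod.neutral)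
    then have "(\<Sum>A\<in>Pow V. subset_weight p V A * of_bool (v \<notin> A)) =
        (\<Prod>u\<in>V. 1 - p * (1 - of_bool (u \<noteq> v)))"
      using sum_subset_weight_prod[OF assms, of p "\<lambda>u. of_bool (u \<noteq> v)"] by simp
    also have "\<dots> = (\<Prod>u\<in>V. if u = v then 1 - p else 1)"
      by (intro prod.cong) auto
    also have "\<dots> = 1 - p"
      using assms that by simp
    finally show ?thesis .
  qed
  have "real (card A) = (\<Sum>v\<in>V. 1 - of_bool (v \<notin> A))" if "A \<in> Pow V" for A
  proof -
    have "(\<Sum>v\<in>V. 1 - of_bool (v \<notin> A)) = (\<Sum>v\<in>V. if v \<in> A then 1 else (0::real))"
      by (intro sum.cong) auto
    also have "\<dots> = real (card (V \<inter> A))"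
      using assms by (simp add: sum.If_cases Int_def)
    also have "V \<inter> A = A" using that by auto
    finally show ?thesis ..
  qed
  then have "(\<Sum>A\<in>Pow V. subset_weight p V A * real (card A)) =
      (\<Sum>A\<in>Pow V. \<Sum>v\<in>V. subset_weight p V A * (1 - of_bool (v \<notin> A)))"
    by (simp add: sum_distrib_left)
  also have "\<dots> = (\<Sum>v\<in>V. \<Sum>A\<in>Pow V. subset_weight p V A * (1 - of_bool (v \<notin> A)))"
    by (rule sum.swap)
  also have "\<dots> = (\<Sum>v\<in>V. p)"
    using not_mem sum_subset_weight[OF assms]
    by (intro sum.cong) (simp_all add: right_diff_distrib sum_subtractf)
  finally show ?thesis by simp
qed

lemma sum_subset_weight_power_card_Int:
  assumes "finite V" "S \<subseteq> V"
  shows "(\<Sum>A\<in>Pow V. subset_weight p V A * q ^ card (S \<inter> A)) = (1 - p * (1 - q)) ^ card S"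
proof -
  have "(\<Prod>u\<in>A. if u \<in> S then q else 1) = q ^ card (S \<inter> A)" if "A \<in> Pow V" for A
    using that finite_subset[OF _ assms(1), of A] by (simp add: prod.If_cases Int_def conj_commute)
  then have "(\<Sum>A\<in>Pow V. subset_weight p V A * q ^ card (S \<inter> A)) =
      (\<Prod>u\<in>V. 1 - p * (1 - (if u \<in> S then q else 1)))"
    using sum_subset_weight_prod[OF assms(1), of p "\<lambda>u. if u \<in> S then q else 1"] by simp
  also have "\<dots> = (\<Prod>u\<in>V. if u \<in> S then 1 - p * (1 - q) else 1)"
    by (intro prod.cong) auto
  also have "\<dots> = (1 - p * (1 - q)) ^ card S"
  proof -
    have "V \<inter> {u. u \<in> S} = S" using assms(2) by auto
    then show ?thesis using assms(1) by (simp add: prod.If_cases)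
  qed
  finally show ?thesis .
qed

section \<open>The lower tail\<close>

text \<open>
  The left-hand side is the rate in the optimised Chernoff bound for the lower tail: falling below
  \<open>1 - c\<close> times the mean \<open>L\<close> has probability at most \<open>exp\<close> of \<open>- L\<close> times this rate. The
  difference of the two sides vanishes at \<open>c = 0\<close> and has derivative
  \<open>- ln (1 - c) - c \<ge> 0\<close>.
\<close>

lemma chernoff_exponent:
  fixes c :: real
  assumes "0 \<le> c" "c < 1"
  shows "(1 - c) * ln (1 - c) + c \<ge> c\<^sup>2 / 2"
proof -
  define f where "f x = (1 - x) * ln (1 - x) + x - x\<^sup>2 / 2" for x :: real
  have "f 0 \<le> f c"
  proof (rule DERIV_nonneg_imp_nondecreasing[OF assms(1)])
    fix x :: real
    assume x: "0 \<le> x" "x \<le> c"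
    have "(f has_real_derivative - ln (1 - x) - x) (at x)"
      unfolding f_def using x assms(2) by (auto intro!: derivative_eq_intros)
    moreover have "ln (1 - x) \<le> - x"
      using ln_le_minus_one[of "1 - x"] x assms(2) by simp
    ultimately show "\<exists>y. (f has_real_derivative y) (at x) \<and> 0 \<le> y"
      by force
  qed
  then show ?thesis by (simp add: f_def)
qed

text \<open>
  Markov's inequality for \<open>(1 - c) ^ X\<close>, where \<open>X = \<bar>S \<inter> A\<bar>\<close> has mean at least \<open>L\<close>. The base
  \<open>1 - c\<close> is the one that makes the bound for \<open>X < (1 - c) L\<close> optimal. Strictness comes
  from \<open>1 - x < exp (- x)\<close>.
\<close>

lemma expected_deficiency_less:
  fixes p c L :: real and m :: nat
  assumes "finite V" "S \<subseteq> V"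
    and p: "0 < p" "p \<le> 1" and c: "0 < c" "c < 1"
    and L: "0 < L" "L \<le> p * real (card S)"
    and m: "0 < m" "real m \<le> (1 - c) * L"
  shows "(\<Sum>A\<in>Pow V. subset_weight p V A * real (m - card (S \<inter> A))) < real m * exp (- (c\<^sup>2 / 2 * L))"
proof -
  let ?q = "1 - c"
  let ?K = "?q powr (- (?q * L))"
  \<comment> \<open>If \<open>\<bar>S \<inter> A\<bar> < m \<le> (1 - c) L\<close>, then \<open>?K\<close> makes the exponential factor at least 1.\<close>
  have deficiency: "real (m - card (S \<inter> A)) \<le> real m * ?K * ?q ^ card (S \<inter> A)" for A
  proof (cases "card (S \<inter> A) < m")
    case True
    have "1 = ?q powr 0" using c by simp
    also have "\<dots> \<le> ?q powr (real (card (S \<inter> A)) - ?q * L)"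
      using True c m by (intro powr_mono') auto
    also have "\<dots> = ?K * ?q ^ card (S \<inter> A)"
      using c by (simp add: powr_diff powr_minus powr_realpow divide_inverse)
    finally have "real m * 1 \<le> real m * (?K * ?q ^ card (S \<inter> A))"
      by (intro mult_left_mono) auto
    then show ?thesis by simp
  next
    case False
    then show ?thesis using c by simp
  qed
  have card_pos: "card S > 0"
    using L p by (cases "card S = 0") auto
  have "(\<Sum>A\<in>Pow V. subset_weight p V A * real (m - card (S \<inter> A)))
      \<le> (\<Sum>A\<in>Pow V. subset_weight p V A * (real m * ?K * ?q ^ card (S \<inter> A)))"
    using p by (intro sum_mono mult_left_mono deficiency subset_weight_nonneg) auto
  also have "\<dots> = real m * ?K * (\<Sum>A\<in>Pow V. subset_weight p V A * ?q ^ card (S \<inter> A))"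
    by (simp add: sum_distrib_left mult_ac)
  also have "\<dots> = real m * ?K * (1 - p * c) ^ card S"
    using sum_subset_weight_power_card_Int[OF assms(1,2), of p ?q] by simp
  also have "\<dots> < real m * ?K * exp (- (c * L))"
  proof -
    have pc: "0 < p * c" "p * c < 1"
      using p c mult_le_less_imp_less[of p 1 c 1] by auto
    then have "(1 - p * c) ^ card S < exp (- (p * c)) ^ card S"
      using card_pos exp_minus_greater[of "p * c"] by (intro power_strict_mono) auto
    also have "\<dots> = exp (- (c * (p * real (card S))))"
      by (simp add: exp_of_nat_mult[symmetric] mult_ac)
    also have "\<dots> \<le> exp (- (c * L))"
      using L c by simp
    finally show ?thesis
      using m c by (intro mult_strict_left_mono) auto
  qed
  also have "\<dots> = real m * exp (- (((1 - c) * ln (1 - c) + c) * L))"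
    using c by (simp add: powr_def exp_add[symmetric] algebra_simps)
  also have "\<dots> \<le> real m * exp (- (c\<^sup>2 / 2 * L))"
    using chernoff_exponent[of c] c L by (intro mult_left_mono) (auto intro: mult_right_mono)
  finally show ?thesis .
qed

section \<open>Multiple transversals\<close>

text \<open>
  Giving each deficient \<open>S i\<close> its missing elements costs at most the total deficiency; an
  element added for one index can only help the others.
\<close>

lemma repair_to_multiple_transversal:
  assumes "finite V" "finite I"
    and S: "\<And>i. i \<in> I \<Longrightarrow> S i \<subseteq> V" "\<And>i. i \<in> I \<Longrightarrow> m \<le> card (S i)"
    and A: "A \<subseteq> V"
  shows "\<exists>D. D \<subseteq> V \<and> (\<forall>i\<in>I. m \<le> card (S i \<inter> D)) \<and>
    card D \<le> card A + (\<Sum>i\<in>I. m - card (S i \<inter> A))"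
proof -
  have "\<exists>B. B \<subseteq> S i - A \<and> card B = m - card (S i \<inter> A)" if i: "i \<in> I" for i
  proof -
    have "finite (S i)" using S(1)[OF i] assms(1) by (rule finite_subset)
    then have "card (S i - A) = card (S i) - card (S i \<inter> A)"
      by (simp add: card_Diff_subset_Int)
    then have "m - card (S i \<inter> A) \<le> card (S i - A)"
      using S(2)[OF i] by simp
    then obtain B where "B \<subseteq> S i - A" "card B = m - card (S i \<inter> A)"
      by (rule obtain_subset_with_card_n)
    then show ?thesis by blast
  qed
  then obtain B where "\<forall>i\<in>I. B i \<subseteq> S i - A \<and> card (B i) = m - card (S i \<inter> A)"
    using bchoice[of I "\<lambda>i B. B \<subseteq> S i - A \<and> card B = m - card (S i \<inter> A)"] by blast
  then have B: "\<And>i. i \<in> I \<Longrightarrow> B i \<subseteq> S i - A"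
      "\<And>i. i \<in> I \<Longrightarrow> card (B i) = m - card (S i \<inter> A)"
    by auto
  let ?D = "A \<union> (\<Union>i\<in>I. B i)"
  have D: "?D \<subseteq> V" using A B(1) S(1) by blast
  show ?thesis
  proof (intro exI[of _ ?D] conjI ballI)
    show "?D \<subseteq> V" by (fact D)
    show "m \<le> card (S i \<inter> ?D)" if i: "i \<in> I" for i
    proof -
      have fin: "finite (S i)" using S(1)[OF i] assms(1) by (rule finite_subset)
      have "m \<le> card (S i \<inter> A) + card (B i)" using B(2)[OF i] by simp
      also have "\<dots> = card (S i \<inter> A \<union> B i)"
        using fin B(1)[OF i] by (intro card_Un_disjoint[symmetric]) (auto intro: finite_subset)
      also have "\<dots> \<le> card (S i \<inter> ?D)"
        using fin B(1)[OF i] i by (intro card_mono) auto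
      finally show ?thesis .
    qed
    have "card ?D \<le> card A + card (\<Union>i\<in>I. B i)" by (rule card_Un_le)
    also have "card (\<Union>i\<in>I. B i) \<le> (\<Sum>i\<in>I. card (B i))" using assms(2) by (rule card_UN_le)
    also have "(\<Sum>i\<in>I. card (B i)) = (\<Sum>i\<in>I. m - card (S i \<inter> A))"
      using B(2) by simp
    finally show "card ?D \<le> card A + (\<Sum>i\<in>I. m - card (S i \<inter> A))" by simp
  qed
qed

text \<open>
  The expected size of the repaired random set is less than the bound, so some outcome is
  that small. The constant \<open>L\<close> is a common lower bound for the mean number of chosen elements
  of each \<open>S i\<close>.
\<close>

lemma small_multiple_transversal:
  fixes p c L :: real and m :: nat
  assumes "finite V" "finite I" "I \<noteq> {}"
    and S: "\<And>i. i \<in> I \<Longrightarrow> S i \<subseteq> V"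
    and p: "0 < p" "p \<le> 1" and c: "0 < c" "c < 1"
    and L: "0 < L" "\<And>i. i \<in> I \<Longrightarrow> L \<le> p * real (card (S i))"
    and m: "0 < m" "real m \<le> (1 - c) * L"
  shows "\<exists>D. D \<subseteq> V \<and> (\<forall>i\<in>I. m \<le> card (S i \<inter> D)) \<and>
    real (card D) < p * real (card V) + real m * exp (- (c\<^sup>2 / 2 * L)) * real (card I)"
proof -
  let ?bound = "p * real (card V) + real m * exp (- (c\<^sup>2 / 2 * L)) * real (card I)"
  let ?size = "\<lambda>A. real (card A) + (\<Sum>i\<in>I. real (m - card (S i \<inter> A)))"
  have "(\<Sum>A\<in>Pow V. subset_weight p V A * ?size A) = p * real (card V) +
      (\<Sum>i\<in>I. \<Sum>A\<in>Pow V. subset_weight p V A * real (m - card (S i \<inter> A)))"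
    unfolding distrib_left sum.distrib sum_distrib_left sum_subset_weight_card[OF assms(1)]
    by (simp only: sum.swap[of _ "Pow V"])
  also have "\<dots> < p * real (card V) + (\<Sum>i\<in>I. real m * exp (- (c\<^sup>2 / 2 * L)))"
    using expected_deficiency_less[OF assms(1) S p c L m] assms(2,3)
    by (intro add_strict_left_mono sum_strict_mono)
  finally have expected: "(\<Sum>A\<in>Pow V. subset_weight p V A * ?size A) < ?bound"
    by (simp add: mult_ac)
  have "\<exists>A\<in>Pow V. ?size A < ?bound"
  proof (rule ccontr)
    assume "\<not> ?thesis"
    then have "(\<Sum>A\<in>Pow V. subset_weight p V A * ?bound) \<le>
        (\<Sum>A\<in>Pow V. subset_weight p V A * ?size A)"
      using p by (intro sum_mono mult_left_mono subset_weight_nonneg) (auto simp: not_less)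
    then show False
      using expected sum_subset_weight[OF assms(1), of p]
      by (simp add: sum_distrib_right[symmetric])
  qed
  then obtain A where A: "A \<subseteq> V" "?size A < ?bound" by blast
  have large: "m \<le> card (S i)" if "i \<in> I" for i
  proof -
    have "real m \<le> 1 * L"
      using m(2) c L(1) by (intro order_trans[OF m(2)] mult_right_mono) auto
    also have "\<dots> \<le> 1 * real (card (S i))"
      using L(2)[OF that] p mult_right_mono[of p 1 "real (card (S i))"] by simp
    finally show ?thesis by simp
  qed
  obtain D where D: "D \<subseteq> V" "\<forall>i\<in>I. m \<le> card (S i \<inter> D)"
      "card D \<le> card A + (\<Sum>i\<in>I. m - card (S i \<inter> A))"
    using repair_to_multiple_transversal[where S = S, OF assms(1,2) S large A(1)] by blast
  have "real (card D) \<le> real (card A + (\<Sum>i\<in>I. m - card (S i \<inter> A)))"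
    using D(3) by (rule of_nat_mono)
  also have "\<dots> = ?size A" by simp
  also note A(2)
  finally show ?thesis using D(1,2) by (intro exI[of _ D] conjI)
qed

section \<open>Parametric domination\<close>

lemma (in pair_graph) kl_domination_number_le:
  assumes "kl_dominating k l G D"
  shows "kl_domination_number k l G \<le> card D"
proof -
  have "{D. kl_dominating k l G D} \<subseteq> Pow (pverts G)"
    by (auto simp: kl_dominating_def)
  then have "finite {D. kl_dominating k l G D}"
    by (rule finite_subset) (simp add: pair_finite_verts)
  then show ?thesis
    unfolding kl_domination_number_def using assms by (intro Min_le) auto
qed

theorem theorem13:
  fixes G :: "'a pair_pre_digraph" and k l \<mu> \<delta> n :: nat and c :: real
  assumes "k \<ge> 1" and "l \<ge> 1" and "\<mu> = max k l"
    and "0 < c" and "c < 1"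
    and "pair_graph G" and "pverts G \<noteq> {}"
    and "n = card (pverts G)" and "\<delta> = min_degree G"
    and "real \<mu> \<le> (1 - c) * ln (real \<delta>)"
  shows "real (kl_domination_number k l G)
           < (ln (real \<delta>) / (real \<delta> + 1) + real \<mu> / real \<delta> powr (0.5 * c\<^sup>2)) * real n"
proof -
  interpret pair_graph G by fact
  define p where "p = ln (real \<delta>) / (real \<delta> + 1)"
  have "0 < (1 - c) * ln (real \<delta>)"
    using assms(1,3,10) by linarith
  then have ln_pos: "0 < ln (real \<delta>)"
    using assms(5) by (simp add: zero_less_mult_iff)
  then have \<delta>_pos: "0 < real \<delta>" by (cases "\<delta> = 0") auto
  have p: "0 < p" "p \<le> 1"
    using ln_pos \<delta>_pos ln_le_minus_one[of "real \<delta>"] by (auto simp: p_def)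
  have nbhd: "ln (real \<delta>) \<le> p * real (card (closed_nbhd G v))" if "v \<in> pverts G" for v
  proof -
    have "\<delta> \<le> out_degree (with_proj G) v"
      unfolding assms(9) min_degree_def using that pair_finite_verts by (intro Min_le) auto
    then have "p * (real \<delta> + 1) \<le> p * real (card (closed_nbhd G v))"
      using card_closed_nbhd[OF that] p(1) by (intro mult_left_mono) auto
    then show ?thesis by (simp add: p_def)
  qed
  have \<mu>_pos: "0 < \<mu>" using assms(1,3) by simp
  obtain D where D: "D \<subseteq> pverts G" "\<forall>v\<in>pverts G. \<mu> \<le> card (closed_nbhd G v \<inter> D)"
    "real (card D) < p * real (card (pverts G)) +
       real \<mu> * exp (- (c\<^sup>2 / 2 * ln (real \<delta>))) * real (card (pverts G))"
    using small_multiple_transversal[where S = "closed_nbhd G", OF pair_finite_verts pair_finite_verts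
        assms(7) closed_nbhd_subset p assms(4,5) ln_pos nbhd \<mu>_pos assms(10)] by blast
  have tail: "exp (- (c\<^sup>2 / 2 * ln (real \<delta>))) = 1 / real \<delta> powr (0.5 * c\<^sup>2)"
  proof -
    have "real \<delta> powr (0.5 * c\<^sup>2) = exp (c\<^sup>2 / 2 * ln (real \<delta>))"
      using \<delta>_pos by (simp add: powr_def)
    then show ?thesis by (simp only: exp_minus inverse_eq_divide)
  qed
  have "kl_dominating k l G D"
    using D(1,2) assms(3) by (force simp: kl_dominating_def)
  then have "real (kl_domination_number k l G) \<le> real (card D)"
    by (intro of_nat_mono kl_domination_number_le)
  also note D(3)[unfolded tail]
  also have "p * real (card (pverts G)) +
        real \<mu> * (1 / real \<delta> powr (0.5 * c\<^sup>2)) * real (card (pverts G)) =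
      (ln (real \<delta>) / (real \<delta> + 1) + real \<mu> / real \<delta> powr (0.5 * c\<^sup>2)) * real n"
    unfolding p_def assms(8) by (simp only: distrib_right times_divide_eq_right mult_1_right)
  finally show ?thesis .
qed

end
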